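(* Let $m\geq 3$ and $h\geq 1$ be integers with $(m,h)\notin\{(3,1),(4,1)\}$, and let $\overline{\Gamma_{m^h}}=\overline{C_{m^h}(1,m,m^2,\ldots,m^{h-1})}$ be the complement of the circulant graph $C_{m^h}(1,m,m^2,\ldots,m^{h-1})$. Then its vertex-forwarding index is $$\xi(\overline{\Gamma_{m^h}})=2h.$$
   Context: For $S\subseteq\mathbb{Z}_n\setminus\{0\}$, the circulant graph $C_n(S)$ is the simple undirected graph with vertex set $\mathbb{Z}_n=\{0,1,\ldots,n-1\}$ and edge set $\{\{g,g+s\}: g\in\mathbb{Z}_n, s\in S\}$ (addition mod $n$); $C_n(s_1,\ldots,s_t)$ means $C_n(\{s_1,\ldots,s_t\})$. $\overline{\Gamma}$ denotes the complement of $\Gamma$. A routing $R$ of a connected graph $\Gamma$ on $n$ vertices is a set of $n(n-1)$ elementary (i.e. simple) paths $R(x,y)$, one from $x$ to $y$ for every ordered pair $(x,y)$ of distinct vertices. The load $\xi_x(\Gamma,R)$ of a vertex $x$ is the number of paths of $R$ having $x$ as an inner (non-end) vertex. Put $\xi(\Gamma,R)=\max_{x\in V(\Gamma)}\xi_x(\Gamma,R)$. The vertex-forwarding index is $\xi(\Gamma)=\min_R \xi(\Gamma,R)$, the minimum over all routings $R$ of $\Gamma$. *)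

theory Defs
  imports "Graph_Theory.Graph_Theory"
begin

text \<open>
  As in \<^theory>\<open>Graph_Theory.Graph_Theory\<close>, a simple undirected graph is a finite symmetric
  loop-free digraph without parallel arcs (locale \<^locale>\<open>pair_graph\<close>): the edge \<open>{u, v}\<close> is the
  pair of arcs \<open>(u, v)\<close>, \<open>(v, u)\<close>.
\<close>

definition circulant :: "nat \<Rightarrow> nat set \<Rightarrow> nat pair_pre_digraph" where
  "circulant n S = \<lparr> pverts = {0..<n},
     parcs = {(g, (g + s) mod n) | g s. g \<in> {0..<n} \<and> s \<in> S}
           \<union> {((g + s) mod n, g) | g s. g \<in> {0..<n} \<and> s \<in> S} \<rparr>"

definition graph_complement :: "'a pair_pre_digraph \<Rightarrow> 'a pair_pre_digraph" where
  "graph_complement G = \<lparr> pverts = pverts G,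
     parcs = {(u, v). u \<in> pverts G \<and> v \<in> pverts G \<and> u \<noteq> v \<and> (u, v) \<notin> parcs G} \<rparr>"

lemma pair_graph_circulant:
  assumes "S \<subseteq> {0<..<n}"
  shows "pair_graph (circulant n S)"
proof -
  let ?G = "circulant n S"
  have sub: "parcs ?G \<subseteq> {0..<n} \<times> {0..<n}"
    by (force simp: circulant_def)
  have ne: "(g + s) mod n \<noteq> g" if "g < n" "s \<in> S" for g s
  proof (cases "g + s < n")
    case True
    with that assms show ?thesis by auto
  next
    case False
    moreover have "s < n" using that assms by auto
    ultimately have "(g + s) mod n = g + s - n"
      using \<open>g < n\<close> by (simp add: le_mod_geq)
    with False \<open>s < n\<close> show ?thesis by linarith
  qed
  have loopfree: "fst e \<noteq> snd e" if "e \<in> parcs ?G" for e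
    using that ne by (force simp: circulant_def)
  show ?thesis
  proof (unfold_locales, goal_cases)
    case (1 e) with sub show ?case by (auto simp: circulant_def)
  next
    case (2 e) with sub show ?case by (auto simp: circulant_def)
  next
    case 3 show ?case by (simp add: circulant_def)
  next
    case 4 show ?case using sub by (rule finite_subset) simp
  next
    case (5 e) thus ?case by (rule loopfree)
  next
    case 6 show ?case unfolding symmetric_def with_proj_simps
      by (rule symI) (simp add: circulant_def, blast)
  qed
qed

lemma pair_graph_graph_complement:
  assumes "pair_graph G"
  shows "pair_graph (graph_complement G)"
proof -
  interpret pair_graph G by fact
  let ?G = "graph_complement G"
  have sub: "parcs ?G \<subseteq> pverts G \<times> pverts G"
    by (auto simp: graph_complement_def)
  have sym_G: "sym (parcs G)"
    using sym_arcs by (simp add: symmetric_def)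
  show ?thesis
  proof (unfold_locales, goal_cases)
    case (1 e) with sub show ?case by (auto simp: graph_complement_def)
  next
    case (2 e) with sub show ?case by (auto simp: graph_complement_def)
  next
    case 3 show ?case by (simp add: graph_complement_def)
  next
    case 4 show ?case using sub by (rule finite_subset) simp
  next
    case (5 e) thus ?case by (auto simp: graph_complement_def)
  next
    case 6 show ?case unfolding symmetric_def with_proj_simps
      using sym_G by (auto simp: graph_complement_def sym_def)
  qed
qed

text \<open>
  A routing is given as the family of its paths \<open>R x y\<close>; only the values at distinct vertices
  \<open>x\<close>, \<open>y\<close> matter. An \<open>apath\<close> is a walk without repeated vertices, i.e. an elementary path.
\<close>

definition routing :: "('a, 'b) pre_digraph \<Rightarrow> ('a \<Rightarrow> 'a \<Rightarrow> 'b awalk) \<Rightarrow> bool" where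
  "routing G R \<longleftrightarrow>
     (\<forall>x \<in> verts G. \<forall>y \<in> verts G. x \<noteq> y \<longrightarrow> pre_digraph.apath G x (R x y) y)"

text \<open>
  Paths of a routing for different pairs \<open>(x, y)\<close> are different, so counting paths
  amounts to counting pairs.
\<close>

definition vertex_load ::
  "('a, 'b) pre_digraph \<Rightarrow> ('a \<Rightarrow> 'a \<Rightarrow> 'b awalk) \<Rightarrow> 'a \<Rightarrow> nat" where
  "vertex_load G R v =
     card {(x, y). x \<in> verts G \<and> y \<in> verts G \<and> x \<noteq> y \<and>
                   v \<in> set (pre_digraph.inner_verts G (R x y))}"

definition max_vertex_load ::
  "('a, 'b) pre_digraph \<Rightarrow> ('a \<Rightarrow> 'a \<Rightarrow> 'b awalk) \<Rightarrow> nat" where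
  "max_vertex_load G R = Max (vertex_load G R ` verts G)"

text \<open>
  The infimum of a nonempty set of naturals is its minimum. The set is nonempty iff \<open>G\<close> has a
  routing, i.e. (for nonempty \<open>G\<close>) iff \<open>G\<close> is connected; otherwise the infimum is \<open>0\<close>.
\<close>

definition vertex_forwarding_index :: "('a, 'b) pre_digraph \<Rightarrow> nat" where
  "vertex_forwarding_index G = Inf {max_vertex_load G R | R. routing G R}"

end

theory Submission
  imports Defs
begin

text \<open>
  A path between non-adjacent vertices has an inner vertex, so in a graph on \<open>n\<close> vertices with
  \<open>k * n\<close> ordered non-adjacent pairs the loads of any routing add up to at least \<open>k * n\<close>, and some
  vertex has load at least \<open>k\<close> (\<open>nonadjacent_pairs_le_max_vertex_load\<close>). The complement of a
  \<open>k\<close>-regular graph is such a graph.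

  For the complement of a circulant graph with connection set \<open>D\<close> (closed under negation), this
  average is attained by every routing that uses only direct arcs and paths with one inner vertex
  and is invariant under translation: if the pair \<open>(x, x + d)\<close>, where \<open>d \<in> D\<close>, is always routed
  through \<open>x + a d\<close>, then each \<open>d\<close> contributes exactly one path through a given vertex, and the
  load is \<open>card D\<close> everywhere (\<open>translation_routing_bound\<close>). What is needed is an \<open>a d\<close> such that
  neither \<open>a d\<close> nor \<open>d - a d\<close> lies in \<open>D \<union> {0}\<close>. Each of the two conditions excludes
  \<open>card D + 1\<close> residues, and \<open>0\<close> and \<open>d\<close> are excluded by both, so at most \<open>2 * card D\<close> residues
  are lost and \<open>2 * card D < n\<close> suffices (\<open>midpoint_exists\<close>).

  For \<open>n = m ^ h\<close> and \<open>S = {1, m, \<dots>, m ^ (h - 1)}\<close> the residues \<open>\<plusminus> m ^ i\<close> are pairwise different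
  as \<open>m > 2\<close>, so \<open>card D = 2 * h\<close>, and \<open>4 * h < m ^ h\<close> fails exactly in the two excluded cases.
\<close>

section \<open>Averaging over non-adjacent pairs\<close>

lemma (in wf_digraph) inner_verts_nonempty_if_nonadjacent:
  assumes "apath u p v" "u \<noteq> v" "\<not> u \<rightarrow> v"
  shows "inner_verts p \<noteq> []"
proof -
  have "p \<noteq> []" using assms by (auto simp: apath_Nil_iff)
  then obtain e p' where p: "p = e # p'" by (cases p) auto
  have "p' \<noteq> []"
    using assms p by (auto simp: apath_def awalk_simps intro: in_arcs_imp_in_arcs_ends)
  thus ?thesis by (simp add: p inner_verts_def)
qed

lemma (in wf_digraph) inner_verts_in_verts:
  assumes "apath u p v"
  shows "set (inner_verts p) \<subseteq> verts G"
proof -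
  have "set (inner_verts p) \<subseteq> set (map (tail G) p)"
    unfolding inner_verts_def by (cases p) auto
  thus ?thesis using assms tail_in_verts by (fastforce simp: apath_def awalk_def)
qed

lemma (in fin_digraph) nonadjacent_pairs_le_max_vertex_load:
  assumes R: "routing G R"
  shows "card {(x, y). x \<in> verts G \<and> y \<in> verts G \<and> x \<noteq> y \<and> \<not> x \<rightarrow> y}
           \<le> card (verts G) * max_vertex_load G R"
    (is "card ?N \<le> _")
proof -
  define L where "L v = {(x, y). x \<in> verts G \<and> y \<in> verts G \<and> x \<noteq> y \<and>
                             v \<in> set (inner_verts (R x y))}" for v
  have fin: "finite (L v)" for v
    by (rule finite_subset[of _ "verts G \<times> verts G"]) (auto simp: L_def)
  have "?N \<subseteq> (\<Union>v\<in>verts G. L v)"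
  proof clarify
    fix x y
    assume xy: "x \<in> verts G" "y \<in> verts G" "x \<noteq> y" "\<not> x \<rightarrow> y"
    hence ap: "apath x (R x y) y" using R by (simp add: routing_def)
    then obtain v where "v \<in> set (inner_verts (R x y))"
      using inner_verts_nonempty_if_nonadjacent xy by (metis last_in_set)
    with xy inner_verts_in_verts[OF ap] show "(x, y) \<in> (\<Union>v\<in>verts G. L v)"
      by (auto simp: L_def)
  qed
  hence "card ?N \<le> card (\<Union>v\<in>verts G. L v)" by (intro card_mono) (use fin in auto)
  also have "\<dots> \<le> (\<Sum>v\<in>verts G. card (L v))" by (rule card_UN_le) simp
  also have "\<dots> \<le> (\<Sum>v\<in>verts G. max_vertex_load G R)"
    by (intro sum_mono) (simp add: max_vertex_load_def vertex_load_def L_def)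
  finally show ?thesis by simp
qed

section \<open>Differences of residues\<close>

text \<open>
  The representative of \<open>v - u\<close> modulo \<open>n\<close>, for \<open>u, v < n\<close>. The case distinction avoids \<open>mod\<close>, so
  that linear arithmetic applies.
\<close>

definition mod_diff :: "nat \<Rightarrow> nat \<Rightarrow> nat \<Rightarrow> nat" where
  "mod_diff n u v = (if u \<le> v then v - u else v + n - u)"

lemma add_mod_if:
  assumes "u < n" "v < n"
  shows "(u + v) mod n = (if u + v < n then u + v else u + v - n :: nat)"
  using assms by (simp add: le_mod_geq)

lemma mod_diff_less: "u < n \<Longrightarrow> v < n \<Longrightarrow> mod_diff n u v < n"
  by (auto simp: mod_diff_def)

lemma mod_diff_eq_0_iff: "u < n \<Longrightarrow> v < n \<Longrightarrow> mod_diff n u v = 0 \<longleftrightarrow> u = v"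
  by (auto simp: mod_diff_def)

lemma mod_diff_eq_iff:
  "u < n \<Longrightarrow> v < n \<Longrightarrow> d < n \<Longrightarrow> mod_diff n u v = d \<longleftrightarrow> v = (u + d) mod n"
  by (auto simp: mod_diff_def add_mod_if)

lemma mod_diff_add: "u < n \<Longrightarrow> d < n \<Longrightarrow> mod_diff n u ((u + d) mod n) = d"
  by (auto simp: mod_diff_def add_mod_if)

lemma mod_diff_translate:
  "u < n \<Longrightarrow> a < n \<Longrightarrow> d < n \<Longrightarrow> mod_diff n ((u + a) mod n) ((u + d) mod n) = mod_diff n a d"
  by (auto simp: mod_diff_def add_mod_if)

lemma mod_diff_invol: "a < n \<Longrightarrow> d < n \<Longrightarrow> mod_diff n (mod_diff n a d) d = a"
  by (auto simp: mod_diff_def)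

lemma add_mod_cancel_right:
  "x < n \<Longrightarrow> y < n \<Longrightarrow> a < n \<Longrightarrow> (x + a) mod n = (y + a) mod n \<Longrightarrow> x = (y::nat)"
  by (auto simp: add_mod_if split: if_splits)

section \<open>Complements of circulant graphs\<close>

definition symmetric_closure_mod :: "nat \<Rightarrow> nat set \<Rightarrow> nat set" where
  "symmetric_closure_mod n S = S \<union> (\<lambda>s. n - s) ` S"

lemma symmetric_closure_mod_subset:
  "S \<subseteq> {0<..<n} \<Longrightarrow> symmetric_closure_mod n S \<subseteq> {0<..<n}"
  by (auto simp: symmetric_closure_mod_def)

lemma circulant_arc_iff:
  assumes S: "S \<subseteq> {0<..<n}" and u: "u < n" and v: "v < n"
  shows "(u, v) \<in> parcs (circulant n S) \<longleftrightarrow> mod_diff n u v \<in> symmetric_closure_mod n S"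
proof -
  have "(\<exists>s\<in>S. v = (u + s) mod n) \<longleftrightarrow> mod_diff n u v \<in> S"
    using mod_diff_eq_iff[OF u v] mod_diff_less[OF u v] S by (metis greaterThanLessThan_iff subsetD)
  moreover have "u = (v + s) mod n \<longleftrightarrow> mod_diff n u v = n - s" if "s \<in> S" for s
  proof -
    have "0 < s" "s < n" using that S by auto
    thus ?thesis using u v by (auto simp: add_mod_if mod_diff_def)
  qed
  hence "(\<exists>s\<in>S. u = (v + s) mod n) \<longleftrightarrow> mod_diff n u v \<in> (\<lambda>s. n - s) ` S"
    by (auto simp: image_iff)
  ultimately show ?thesis
    using u v by (auto simp: circulant_def symmetric_closure_mod_def)
qed

lemma verts_complement_circulant [simp]:
  "pverts (graph_complement (circulant n S)) = {0..<n}"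
  by (simp add: graph_complement_def circulant_def)

lemma complement_circulant_arc_iff:
  assumes "S \<subseteq> {0<..<n}" "u < n" "v < n"
  shows "(u, v) \<in> parcs (graph_complement (circulant n S))
           \<longleftrightarrow> mod_diff n u v \<notin> insert 0 (symmetric_closure_mod n S)"
  using assms circulant_arc_iff[OF assms] mod_diff_eq_0_iff[of u n v]
  by (auto simp: graph_complement_def circulant_def)

lemma card_nonadjacent_pairs_complement_circulant:
  assumes S: "S \<subseteq> {0<..<n}"
  shows "card {(x, y). x \<in> {0..<n} \<and> y \<in> {0..<n} \<and> x \<noteq> y \<and>
                 (x, y) \<notin> parcs (graph_complement (circulant n S))}
           = n * card (symmetric_closure_mod n S)"
    (is "card ?N = _")
proof -
  let ?D = "symmetric_closure_mod n S"
  have D: "?D \<subseteq> {0<..<n}" using S by (rule symmetric_closure_mod_subset)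
  have N: "?N = {(x, y). x < n \<and> y < n \<and> mod_diff n x y \<in> ?D}"
    using complement_circulant_arc_iff[OF S] mod_diff_eq_0_iff D by fastforce
  have "bij_betw (\<lambda>(x, d). (x, (x + d) mod n)) ({0..<n} \<times> ?D) ?N"
    unfolding N
    by (rule bij_betw_byWitness[where f' = "\<lambda>(x, y). (x, mod_diff n x y)"])
       (use D in \<open>fastforce simp: mod_diff_add mod_diff_less
          mod_diff_eq_iff[THEN iffD1, OF _ _ _ refl, symmetric]\<close>)+
  hence "card ?N = card ({0..<n} \<times> ?D)" by (simp add: bij_betw_same_card)
  thus ?thesis by (simp add: card_cartesian_product)
qed

text \<open>
  The excluded residues form \<open>insert 0 D\<close> and its mirror image under \<open>a \<mapsto> d - a\<close>, and the mirror
  swaps \<open>0\<close> and \<open>d\<close>, which both sets contain. Counting these two only once matters: the hypothesis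
  would otherwise have to be \<open>2 * card D + 2 < n\<close>, and the cycle on five vertices (\<open>m = 5\<close>,
  \<open>h = 1\<close>) would be missed.
\<close>

lemma midpoint_exists:
  assumes D: "D \<subseteq> {0<..<n}" and d: "d \<in> D" and n: "2 * card D < n"
  obtains a where "a < n" "a \<notin> insert 0 D" "mod_diff n a d \<notin> insert 0 D"
proof -
  have fin: "finite D" using D finite_subset by blast
  let ?D' = "D - {d}"
  let ?B = "{0, d} \<union> ?D' \<union> (\<lambda>e. mod_diff n e d) ` ?D'"
  have "card ?B \<le> card {0, d} + card ?D' + card ((\<lambda>e. mod_diff n e d) ` ?D')"
    by (meson add_le_mono card_Un_le le_refl le_trans)
  also have "\<dots> \<le> 2 + card ?D' + card ?D'"
    using fin by (intro add_mono card_image_le) (auto simp: card_insert_if)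
  also have "\<dots> = 2 * card D"
    using fin d card_Suc_Diff1[of D d] by simp
  finally have "card ?B < card {0..<n}" using n by simp
  hence "\<not> {0..<n} \<subseteq> ?B"
    using fin card_mono[of ?B "{0..<n}"] by auto
  then obtain a where "a \<in> {0..<n}" "a \<notin> ?B" by blast
  hence a: "a < n" "a \<notin> ?B" by auto
  have dn: "d < n" using D d by auto
  have "mod_diff n a d \<notin> insert 0 D"
  proof
    assume "mod_diff n a d \<in> insert 0 D"
    then consider "mod_diff n a d = 0" | "mod_diff n a d = d" | "mod_diff n a d \<in> ?D'" by auto
    thus False
    proof cases
      case 1
      thus ?thesis using a dn mod_diff_eq_0_iff by auto
    next
      case 2
      hence "a = 0" using mod_diff_invol[OF a(1) dn] by (simp add: mod_diff_def)
      thus ?thesis using a by simp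
    next
      case 3
      hence "mod_diff n (mod_diff n a d) d \<in> ?B" by blast
      thus ?thesis using a mod_diff_invol[OF a(1) dn] by simp
    qed
  qed
  moreover have "a \<notin> insert 0 D" using a by auto
  ultimately show thesis using that a by blast
qed

text \<open>
  A path through \<open>v\<close> is determined by the difference \<open>d\<close> of its ends, since its first vertex must
  be \<open>v - a d\<close>.
\<close>

lemma translation_routing_bound:
  fixes a :: "nat \<Rightarrow> nat" and n :: nat and S :: "nat set"
  defines "D \<equiv> symmetric_closure_mod n S"
  defines "G \<equiv> with_proj (graph_complement (circulant n S))"
  assumes S: "S \<subseteq> {0<..<n}" and n: "0 < n"
    and a: "\<And>d. d \<in> D \<Longrightarrow> a d < n \<and> a d \<notin> insert 0 D \<and> mod_diff n (a d) d \<notin> insert 0 D"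
  shows "\<exists>R. routing G R \<and> max_vertex_load G R \<le> card D"
proof -
  have D: "D \<subseteq> {0<..<n}" unfolding D_def using S by (rule symmetric_closure_mod_subset)
  interpret H: pair_graph "graph_complement (circulant n S)"
    using S by (intro pair_graph_graph_complement pair_graph_circulant)
  have arc: "(u, v) \<in> parcs (graph_complement (circulant n S)) \<longleftrightarrow> mod_diff n u v \<notin> insert 0 D"
    if "u < n" "v < n" for u v
    using that complement_circulant_arc_iff[OF S] by (simp add: D_def)
  define c where "c x y = (x + a (mod_diff n x y)) mod n" for x y
  define R where "R x y = (if mod_diff n x y \<in> D then [(x, c x y), (c x y, y)] else [(x, y)])"
    for x y
  have c: "c x y < n" "mod_diff n x (c x y) \<notin> insert 0 D" "mod_diff n (c x y) y \<notin> insert 0 D"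
    if "x < n" "y < n" "mod_diff n x y \<in> D" for x y
  proof -
    let ?d = "mod_diff n x y"
    have y: "y = (x + ?d) mod n" using that mod_diff_eq_iff mod_diff_less by blast
    show "c x y < n" using n by (simp add: c_def)
    show "mod_diff n x (c x y) \<notin> insert 0 D"
      using a[OF that(3)] that by (simp add: c_def mod_diff_add)
    have "mod_diff n (c x y) y = mod_diff n (a ?d) ?d"
      using a[OF that(3)] that mod_diff_translate[of x n "a ?d" ?d] mod_diff_less[of x n y] y
      by (simp add: c_def)
    thus "mod_diff n (c x y) y \<notin> insert 0 D" using a[OF that(3)] by simp
  qed
  have "routing G R"
    unfolding routing_def
  proof (intro ballI impI)
    fix x y
    assume "x \<in> verts G" "y \<in> verts G" and ne: "x \<noteq> y"
    hence xy: "x < n" "y < n" by (auto simp: G_def)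
    show "pre_digraph.apath G x (R x y) y"
    proof (cases "mod_diff n x y \<in> D")
      case False
      hence "(x, y) \<in> parcs (graph_complement (circulant n S))"
        using arc xy ne mod_diff_eq_0_iff by auto
      thus ?thesis
        using False xy ne by (simp add: R_def G_def H.apath_def H.awalk_def)
    next
      case True
      note cxy = c[OF xy True]
      have "x \<noteq> c x y" "c x y \<noteq> y" using cxy by (auto simp: mod_diff_def)
      moreover have "(x, c x y) \<in> parcs (graph_complement (circulant n S))"
        "(c x y, y) \<in> parcs (graph_complement (circulant n S))"
        using arc cxy xy by auto
      ultimately show ?thesis
        using True xy ne by (simp add: R_def G_def H.apath_def H.awalk_def)
    qed
  qed
  moreover have "max_vertex_load G R \<le> card D"
  proof -
    have "vertex_load G R v \<le> card D" for v
    proof -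
      let ?P = "{(x, y). x \<in> verts G \<and> y \<in> verts G \<and> x \<noteq> y \<and>
                   v \<in> set (pre_digraph.inner_verts G (R x y))}"
      have P: "x < n \<and> y < n \<and> mod_diff n x y \<in> D \<and> v = (x + a (mod_diff n x y)) mod n"
        if "(x, y) \<in> ?P" for x y
        using that by (auto simp: G_def R_def c_def inner_verts_with_proj_def split: if_splits)
      have "inj_on (\<lambda>(x, y). mod_diff n x y) ?P"
      proof (rule inj_onI)
        fix e e'
        assume e: "e \<in> ?P" "e' \<in> ?P"
          and eq_e: "(\<lambda>(x, y). mod_diff n x y) e = (\<lambda>(x, y). mod_diff n x y) e'"
        obtain x y x' y' where xy: "e = (x, y)" "e' = (x', y')" by (metis surj_pair)
        have "(x, y) \<in> ?P" "(x', y') \<in> ?P" using e unfolding xy .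
        note p = P[OF this(1)] P[OF this(2)]
        have eq: "mod_diff n x y = mod_diff n x' y'" using eq_e by (simp add: xy)
        have "x = x'"
          using p eq a add_mod_cancel_right by metis
        moreover have "y = y'"
          using p eq calculation mod_diff_eq_iff mod_diff_less by metis
        ultimately show "e = e'" by (simp add: xy)
      qed
      moreover have "(\<lambda>(x, y). mod_diff n x y) ` ?P \<subseteq> D" using P by fast
      moreover have "finite D" using D finite_subset by blast
      ultimately show ?thesis unfolding vertex_load_def by (rule card_inj_on_le)
    qed
    thus ?thesis using n by (auto simp: max_vertex_load_def G_def)
  qed
  ultimately show ?thesis by blast
qed

theorem vertex_forwarding_index_complement_circulant:
  assumes S: "S \<subseteq> {0<..<n}" and n: "2 * card (symmetric_closure_mod n S) < n"
  shows "vertex_forwarding_index (with_proj (graph_complement (circulant n S)))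
           = card (symmetric_closure_mod n S)"
proof -
  let ?D = "symmetric_closure_mod n S"
  let ?H = "graph_complement (circulant n S)"
  let ?G = "with_proj ?H"
  interpret H: pair_graph ?H
    using S by (intro pair_graph_graph_complement pair_graph_circulant)
  have lower: "card ?D \<le> max_vertex_load ?G R" if "routing ?G R" for R
    using H.nonadjacent_pairs_le_max_vertex_load[OF that]
      card_nonadjacent_pairs_complement_circulant[OF S] n by simp
  have "\<forall>d\<in>?D. \<exists>a. a < n \<and> a \<notin> insert 0 ?D \<and> mod_diff n a d \<notin> insert 0 ?D"
    using midpoint_exists[OF symmetric_closure_mod_subset[OF S] _ n] by metis
  then obtain a where
    "\<forall>d\<in>?D. a d < n \<and> a d \<notin> insert 0 ?D \<and> mod_diff n (a d) d \<notin> insert 0 ?D"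
    by metis
  then obtain R where R: "routing ?G R" "max_vertex_load ?G R \<le> card ?D"
    using translation_routing_bound[OF S, of a] n by auto
  have "max_vertex_load ?G R = card ?D" using R lower by (simp add: le_antisym)
  thus ?thesis
    unfolding vertex_forwarding_index_def
    using R(1) lower by (intro cInf_eq_minimum) (auto, metis)
qed

section \<open>Powers of \<open>m\<close> as connection set\<close>

lemma powers_subset:
  assumes "3 \<le> (m::nat)"
  shows "{m ^ i | i. i < h} \<subseteq> {0<..<m ^ h}"
  using assms by (auto intro: power_strict_increasing)

text \<open>
  All powers below \<open>m ^ h\<close> are at most a third of it, so no power can be the negative of another.
\<close>

lemma card_symmetric_closure_powers:
  assumes m: "3 \<le> (m::nat)"
  shows "card (symmetric_closure_mod (m ^ h) {m ^ i | i. i < h}) = 2 * h"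
proof -
  let ?n = "m ^ h" and ?S = "{m ^ i | i. i < h}"
  have third: "3 * s \<le> ?n \<and> 0 < s" if s: "s \<in> ?S" for s
  proof -
    obtain i where i: "i < h" "s = m ^ i" using s by blast
    have "3 * m ^ i \<le> m ^ Suc i" using m by simp
    also have "\<dots> \<le> m ^ h" using i m by (intro power_increasing) auto
    finally show ?thesis using i m by simp
  qed
  have S: "?S = (\<lambda>i. m ^ i) ` {..<h}" by auto
  have fin: "finite ?S" unfolding S by simp
  have card_S: "card ?S = h"
    unfolding S using m by (subst card_image) (auto simp: inj_on_def power_inject_exp)
  have "s \<noteq> ?n - t" if "s \<in> ?S" "t \<in> ?S" for s t
    using third[OF that(1)] third[OF that(2)] by linarith
  hence disj: "?S \<inter> (\<lambda>s. ?n - s) ` ?S = {}" by blast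
  have inj: "inj_on (\<lambda>s. ?n - s) ?S"
  proof (rule inj_onI)
    fix s t
    assume "s \<in> ?S" "t \<in> ?S" "?n - s = ?n - t"
    thus "s = t" using third[of s] third[of t] by linarith
  qed
  show ?thesis
    unfolding symmetric_closure_mod_def
    using fin disj inj card_S by (simp add: card_Un_disjoint card_image)
qed

lemma four_times_less_power:
  fixes m h :: nat
  assumes m: "m \<ge> 3" and h: "h \<ge> 1" and ne: "(m, h) \<notin> {(3, 1), (4, 1)}"
  shows "4 * h < m ^ h"
proof (cases "h = 1")
  case True
  thus ?thesis using m ne by auto
next
  case False
  hence "2 \<le> h" using h by simp
  hence "4 * h < 3 ^ h" by (induction h rule: dec_induct) auto
  also have "\<dots> \<le> m ^ h" using m by (rule power_mono) simp
  finally show ?thesis .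
qed

theorem corollary5p7:
  fixes m h :: nat
  assumes "m \<ge> 3" and "h \<ge> 1" and "(m, h) \<notin> {(3, 1), (4, 1)}"
  shows "vertex_forwarding_index
           (with_proj (graph_complement (circulant (m ^ h) {m ^ i | i. i < h}))) = 2 * h"
  using vertex_forwarding_index_complement_circulant[OF powers_subset[OF assms(1), of h]]
    four_times_less_power[OF assms]
  by (simp add: card_symmetric_closure_powers[OF assms(1)])

end
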